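(* Let $f_1,\dots,f_n:\mathbb{R}^d\to\mathbb{R}$ be convex and differentiable, with $\nabla f_i$ being $L_i$-Lipschitz in the Euclidean norm, let $L_{\max}=\max\{L_1,\dots,L_n\}>0$, let $R:\mathbb{R}^d\to\mathbb{R}$ be $\mu$-strongly convex with $\mu\ge0$ ($\mu=0$ allowed), and suppose that $P=\frac1n\sum_{i=1}^n f_i+R$ has a minimizer $x_*$. Let $\widetilde x_0\in\mathbb{R}^d$, $\eta=5L_{\max}$, $m_1\in\mathbb{N}$ with $m_1\ge1$, and $0\le\alpha\le1$. Then the iterates $\widetilde x_s,\widetilde v_s$ of the SADA algorithm (defined in the context) run with these parameters satisfy, for every stage $s\ge1$, $$\mathbb{E}[P(\widetilde x_s)-P(x_* )]+\frac{\eta+m_s\mu}{2m_s}\,\mathbb{E}\|\widetilde v_s-x_*\|^2\le\frac12\,\mathbb{E}[P(\widetilde x_{s-1})-P(x_* )]+\Big(\frac{\alpha\eta}{2m_s}-\frac{\mu}{4}\Big)\mathbb{E}\|\widetilde x_{s-1}-x_*\|^2+\frac{(1-\alpha)\eta}{2m_s}\,\mathbb{E}\|\widetilde v_{s-1}-x_*\|^2 .$$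
   Context: All norms are Euclidean. $F=\frac1n\sum_{i=1}^n f_i$ and $P=F+R$. $R$ is $\mu$-strongly convex ($\mu\ge0$) means $R(y)\ge R(x)+\xi^\top(y-x)+\frac{\mu}{2}\|y-x\|^2$ for all $x,y\in\mathbb{R}^d$ and all $\xi\in\partial R(x)$. SADA algorithm with inputs $\widetilde x_0\in\mathbb{R}^d$, $\eta>0$, $m_1$, and $\alpha\in[0,1]$: set $\widetilde v_0=\widetilde x_0$. For stages $s=1,2,\dots$: put $x_0=\widetilde x_{s-1}$, $v_0=(1-\alpha)\widetilde v_{s-1}+\alpha\widetilde x_{s-1}$, $u_0=v_0$, $\bar g_0=0$, $\phi_i^0=x_0$ for $i=1,\dots,n$, and $m_s=m_1$ if $\mu>0$, $m_s=2^{s-1}m_1$ if $\mu=0$. For $t=1,\dots,m_s$: draw $i_t$ uniformly from $\{1,\dots,n\}$ independently of all earlier draws (in this and previous stages), set $\phi_{i_t}^t=u_{t-1}$ and $\phi_i^t=\phi_i^{t-1}$ for $i\ne i_t$, and $$g_t=\nabla f_{i_t}(\phi_{i_t}^t)-\nabla f_{i_t}(\phi_{i_t}^{t-1})+\frac1n\sum_{i=1}^n\nabla f_i(\phi_i^{t-1}),\qquad \bar g_t=\Big(1-\frac1t\Big)\bar g_{t-1}+\frac1t g_t,$$ $$v_t=\operatorname*{argmin}_{x\in\mathbb{R}^d}\Big\{\langle\bar g_t,x\rangle+R(x)+\frac{\eta}{2t}\|x-v_0\|^2\Big\},\qquad x_t=\operatorname*{argmin}_{x\in\mathbb{R}^d}\Big\{\langle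 g_t,x\rangle+R(x)+\frac{\eta t}{2}\|x-u_{t-1}\|^2\Big\},$$ $$u_t=\Big(1-\frac1{t+1}\Big)x_t+\frac1{t+1}v_t .$$ Finally put $\widetilde x_s=x_{m_s}$ and $\widetilde v_s=v_{m_s}$. The expectation $\mathbb{E}$ is over all random draws.
   Formalization: Strong convexity of R is taken to include convexity of R; the subgradient inequality alone holds vacuously for functions without subgradients, such as the negative squared norm, and the claim then fails. *)

theory Defs
  imports "HOL-Probability.Probability"
begin

definition gradient :: "('a::euclidean_space \<Rightarrow> real) \<Rightarrow> 'a \<Rightarrow> 'a" where
  "gradient f x = (THE D. GDERIV f x :> D)"

definition subdifferential :: "('a::euclidean_space \<Rightarrow> real) \<Rightarrow> 'a \<Rightarrow> 'a set" where
  "subdifferential R x = {\<xi>. \<forall>y. R y \<ge> R x + \<xi> \<bullet> (y - x)}"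

text \<open>Convexity is a separate conjunct because the subgradient inequality alone holds vacuously
  for functions without subgradients, such as the negative of the squared norm.\<close>

definition strongly_convex :: "real \<Rightarrow> ('a::euclidean_space \<Rightarrow> real) \<Rightarrow> bool" where
  "strongly_convex \<mu> R \<longleftrightarrow> convex_on UNIV R \<and>
     (\<forall>x y. \<forall>\<xi> \<in> subdifferential R x. R y \<ge> R x + \<xi> \<bullet> (y - x) + \<mu> / 2 * (norm (y - x))\<^sup>2)"

text \<open>The state of a stage after inner iteration \<open>t\<close>: \<open>x\<^sub>t\<close>, \<open>v\<^sub>t\<close>, \<open>u\<^sub>t\<close>, the averaged
  gradient estimate, and the reference points \<open>\<phi>\<^sub>i\<close>, of which only \<open>i \<in> {1..n}\<close> matter.\<close>

record 'a sada_state =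
  st_x :: 'a
  st_v :: 'a
  st_u :: 'a
  st_gbar :: 'a
  st_phi :: "nat \<Rightarrow> 'a"

definition sada_init :: "'a::euclidean_space \<Rightarrow> 'a \<Rightarrow> 'a sada_state" where
  "sada_init x0 v0 = \<lparr>st_x = x0, st_v = v0, st_u = v0, st_gbar = 0, st_phi = (\<lambda>i. x0)\<rparr>"

text \<open>Inner iteration \<open>t\<close> (from 1) with drawn index \<open>i\<close>, acting on the state after
  iteration \<open>t - 1\<close>. For convex \<open>R\<close> and positive \<open>\<eta>\<close>, \<open>t\<close> the objectives of both minimizations
  have a unique minimizer, so the choice made by \<^const>\<open>arg_min\<close> is determined.\<close>

definition sada_step ::
  "nat \<Rightarrow> (nat \<Rightarrow> 'a::euclidean_space \<Rightarrow> real) \<Rightarrow> ('a \<Rightarrow> real) \<Rightarrow> real \<Rightarrow> 'a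
    \<Rightarrow> nat \<Rightarrow> nat \<Rightarrow> 'a sada_state \<Rightarrow> 'a sada_state" where
  "sada_step n f R \<eta> v0 t i S =
    (let u = st_u S;
         \<phi> = st_phi S;
         \<phi>' = \<phi>(i := u);
         g = gradient (f i) (\<phi>' i) - gradient (f i) (\<phi> i)
               + (1 / real n) *\<^sub>R (\<Sum>j = 1..n. gradient (f j) (\<phi> j));
         gbar' = (1 - 1 / real t) *\<^sub>R st_gbar S + (1 / real t) *\<^sub>R g;
         v' = (ARG_MIN (\<lambda>z. gbar' \<bullet> z + R z + \<eta> / (2 * real t) * (norm (z - v0))\<^sup>2) z. True);
         x' = (ARG_MIN (\<lambda>z. g \<bullet> z + R z + \<eta> * real t / 2 * (norm (z - u))\<^sup>2) z. True);
         u' = (1 - 1 / real (t + 1)) *\<^sub>R x' + (1 / real (t + 1)) *\<^sub>R v'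
     in \<lparr>st_x = x', st_v = v', st_u = u', st_gbar = gbar', st_phi = \<phi>'\<rparr>)"

text \<open>The argument \<open>i\<close> is the sequence of draws of the stage; \<open>i 0\<close> is unused.\<close>

primrec sada_inner ::
  "nat \<Rightarrow> (nat \<Rightarrow> 'a::euclidean_space \<Rightarrow> real) \<Rightarrow> ('a \<Rightarrow> real) \<Rightarrow> real \<Rightarrow> 'a \<Rightarrow> 'a
    \<Rightarrow> (nat \<Rightarrow> nat) \<Rightarrow> nat \<Rightarrow> 'a sada_state" where
  "sada_inner n f R \<eta> x0 v0 i 0 = sada_init x0 v0"
| "sada_inner n f R \<eta> x0 v0 i (Suc t) =
     sada_step n f R \<eta> v0 (Suc t) (i (Suc t)) (sada_inner n f R \<eta> x0 v0 i t)"

definition sada_stage_length :: "real \<Rightarrow> nat \<Rightarrow> nat \<Rightarrow> nat" where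
  "sada_stage_length \<mu> m\<^sub>1 s = (if \<mu> > 0 then m\<^sub>1 else 2 ^ (s - 1) * m\<^sub>1)"

text \<open>The pair of outer iterates after \<open>s\<close> stages; \<open>i s t\<close> is the draw in inner iteration \<open>t\<close> of
  stage \<open>s\<close>, both counted from 1.\<close>

primrec sada ::
  "nat \<Rightarrow> (nat \<Rightarrow> 'a::euclidean_space \<Rightarrow> real) \<Rightarrow> ('a \<Rightarrow> real) \<Rightarrow> real \<Rightarrow> real \<Rightarrow> nat \<Rightarrow> real \<Rightarrow> 'a
    \<Rightarrow> (nat \<Rightarrow> nat \<Rightarrow> nat) \<Rightarrow> nat \<Rightarrow> 'a \<times> 'a" where
  "sada n f R \<mu> \<eta> m\<^sub>1 \<alpha> xinit i 0 = (xinit, xinit)"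
| "sada n f R \<mu> \<eta> m\<^sub>1 \<alpha> xinit i (Suc s) =
    (let (xt, vt) = sada n f R \<mu> \<eta> m\<^sub>1 \<alpha> xinit i s;
         S = sada_inner n f R \<eta> xt ((1 - \<alpha>) *\<^sub>R vt + \<alpha> *\<^sub>R xt) (i (Suc s))
               (sada_stage_length \<mu> m\<^sub>1 (Suc s))
     in (st_x S, st_v S))"

end

theory Submission
  imports Defs
begin

text \<open>
  One stage of \<open>m\<close> inner iterations is controlled by a potential whose average over the next draw
  never increases. Write \<open>\<psi>\<^sub>t(z) = t (\<langle>g\<^bsub>avg\<^esub>, z\<rangle> + R(z)) + \<eta>/2 \<parallel>z - v\<^sub>0\<parallel>\<^sup>2\<close> for the dual averaging
  model, where \<open>g\<^bsub>avg\<^esub>\<close> is the average of the first \<open>t\<close> gradient estimates and \<open>v\<^sub>t\<close> is the minimizer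
  of \<open>\<psi>\<^sub>t\<close>, and \<open>H\<^sub>t\<close> for the sum over \<open>i\<close> of
  \<open>\<parallel>\<nabla>f\<^sub>i(\<phi>\<^sub>i) - \<nabla>f\<^sub>i(x\<^sub>*)\<parallel>\<^sup>2\<close>. The potential is
  \<open>t (P(x\<^sub>t) - P(x\<^sub>*)) + \<psi>\<^sub>t(x\<^sub>*) - \<psi>\<^sub>t(v\<^sub>t) + min(n, m - t) H\<^sub>t / (4 L n)\<close>.

  Let \<open>D\<^sub>F(y, x) = F(y) - F(x) - \<langle>\<nabla>F(x), y - x\<rangle>\<close> be the Bregman divergence of \<open>F\<close>, and let \<open>u\<close> be the
  point where iteration \<open>t\<close> estimates the gradient.
  The terms without \<open>H\<^sub>t\<close> form the estimate sequence of accelerated gradient methods. Iteration \<open>t\<close>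
  raises their conditional mean by at most the variance of the gradient estimate over \<open>8 L\<close>, minus
  \<open>D\<^sub>F(x\<^sub>*, u)\<close> (lemmas \<open>gap_step\<close> and \<open>sum_gap_step\<close>): the step size
  \<open>1 / (5 L t)\<close> leaves a surplus \<open>2 L t\<^sup>2 \<parallel>x\<^sub>t - u\<parallel>\<^sup>2\<close> of the quadratic term, which absorbs the error
  of the estimate by Young's inequality. The variance is at most
  \<open>2/n\<close> times \<open>G + H\<close>, where \<open>H = H\<^bsub>t-1\<^esub>\<close> and \<open>G\<close> is the value that \<open>H\<close> would have if all reference
  points were \<open>u\<close>, and by co-coercivity \<open>D\<^sub>F(x\<^sub>*, u) \<ge> G / (2 L n)\<close>. So the increase is at most
  \<open>(H - G) / (4 L n)\<close>. Replacing one uniformly chosen reference point by \<open>u\<close> moves \<open>H\<close> towards \<open>G\<close>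
  at rate \<open>1/n\<close>, and the weight \<open>min(n, m - t)\<close> makes this movement pay for the increase
  (lemma \<open>sum_potential_step\<close>).

  At the start of a stage \<open>H\<^sub>0\<close> is at most \<open>2 L n D\<^sub>F(x\<^sub>0, x\<^sub>*)\<close>, and optimality of \<open>x\<^sub>*\<close> with strong
  convexity of \<open>R\<close> gives \<open>D\<^sub>F(x\<^sub>0, x\<^sub>*) \<le> P(x\<^sub>0) - P(x\<^sub>*) - \<mu>/2 \<parallel>x\<^sub>0 - x\<^sub>*\<parallel>\<^sup>2\<close>; this is where the factor \<open>1/2\<close> and the
  term \<open>\<mu>/4\<close> come from (lemma \<open>potential_init_le\<close>). At the end, strong convexity of \<open>\<psi>\<^sub>m\<close> bounds the
  potential from below (lemma \<open>potential_final_ge\<close>).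

  The iterates depend on finitely many draws, so every expectation is a finite average over all
  index sequences (lemma \<open>expectation_uniform_draws\<close>), and conditioning on the past amounts to
  resampling a single coordinate (lemma \<open>sum_PiE_resample\<close>).
\<close>

(* Otherwise simp turns the lower bound of the index set {1..n} into Suc 0, and facts stated with 1 no longer match. *)
declare One_nat_def [simp del]

section \<open>Convex and smooth functions\<close>

lemma gradient_eqI:
  assumes "GDERIV f x :> D"
  shows "gradient f x = D"
  unfolding gradient_def
proof (rule the_equality)
  fix E assume "GDERIV f x :> E"
  then have "(\<lambda>h. h \<bullet> E) = (\<lambda>h. h \<bullet> D)"
    using assms unfolding gderiv_def by (rule has_derivative_unique)
  then show "E = D"
    by (metis inner_commute vector_eq_ldot)
qed (rule assms)

lemma GDERIV_gradient:
  fixes f :: "'a::euclidean_space \<Rightarrow> real"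
  assumes "f differentiable (at x)"
  shows "GDERIV f x :> gradient f x"
proof -
  obtain f' where f': "(f has_derivative f') (at x)"
    using assms unfolding differentiable_def by blast
  interpret linear f'
    using f' by (rule has_derivative_linear)
  have "f' h = h \<bullet> (\<Sum>b\<in>Basis. f' b *\<^sub>R b)" for h
  proof -
    have "f' h = f' (\<Sum>b\<in>Basis. (h \<bullet> b) *\<^sub>R b)"
      by (simp add: euclidean_representation)
    also have "\<dots> = h \<bullet> (\<Sum>b\<in>Basis. f' b *\<^sub>R b)"
      by (simp add: sum scaleR inner_sum_right mult.commute)
    finally show ?thesis .
  qed
  then have "GDERIV f x :> (\<Sum>b\<in>Basis. f' b *\<^sub>R b)"
    using f' unfolding gderiv_def by (metis (no_types, lifting) ext)
  then show ?thesis
    using gradient_eqI by metis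
qed

text \<open>Along the segment from \<open>x\<close> to \<open>z\<close>, the difference between \<open>f\<close> and the quadratic has a nonpositive
  derivative, by Cauchy-Schwarz and the Lipschitz bound.\<close>

lemma quadratic_upper_bound_if_lipschitz_gradient:
  fixes f :: "'a::euclidean_space \<Rightarrow> real"
  assumes deriv: "\<And>z. GDERIV f z :> g z" and lip: "L-lipschitz_on UNIV g"
  shows "f z \<le> f x + g x \<bullet> (z - x) + L / 2 * (norm (z - x))\<^sup>2"
proof -
  define d where "d = z - x"
  define \<phi> where "\<phi> s = f (x + s *\<^sub>R d) - s * (g x \<bullet> d) - L / 2 * (norm d)\<^sup>2 * s\<^sup>2" for s
  have "\<phi> 1 \<le> \<phi> 0"
  proof (rule DERIV_nonpos_imp_nonincreasing[of 0 1 \<phi>])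
    fix s :: real assume s: "0 \<le> s" "s \<le> 1"
    have "((\<lambda>s. f (x + s *\<^sub>R d)) has_derivative (\<lambda>h. (h *\<^sub>R d) \<bullet> g (x + s *\<^sub>R d))) (at s)"
      using deriv[of "x + s *\<^sub>R d"] unfolding gderiv_def
      by (intro has_derivative_compose[where f="\<lambda>s. x + s *\<^sub>R d" and g=f])
        (auto intro!: derivative_eq_intros)
    then have "((\<lambda>s. f (x + s *\<^sub>R d)) has_real_derivative d \<bullet> g (x + s *\<^sub>R d)) (at s)"
      unfolding has_field_derivative_def by (simp add: mult_commute_abs)
    then have "(\<phi> has_real_derivative
        d \<bullet> g (x + s *\<^sub>R d) - g x \<bullet> d - L * (norm d)\<^sup>2 * s) (at s)"
      unfolding \<phi>_def by (auto intro!: derivative_eq_intros)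
    moreover have "d \<bullet> g (x + s *\<^sub>R d) - g x \<bullet> d - L * (norm d)\<^sup>2 * s \<le> 0"
    proof -
      have "d \<bullet> (g (x + s *\<^sub>R d) - g x) \<le> norm d * norm (g (x + s *\<^sub>R d) - g x)"
        by (rule norm_cauchy_schwarz)
      also have "\<dots> \<le> norm d * (L * norm (s *\<^sub>R d))"
        using lipschitz_on_normD[OF lip, of "x + s *\<^sub>R d" x] by (intro mult_left_mono) auto
      finally show ?thesis
        using s by (simp add: inner_diff_right inner_commute power2_eq_square mult_ac)
    qed
    ultimately show "\<exists>y. (\<phi> has_real_derivative y) (at s) \<and> y \<le> 0"
      by blast
  qed simp
  then show ?thesis
    by (simp add: \<phi>_def d_def)
qed

text \<open>First-order optimality. Comparing the minimizer \<open>v\<close> with \<open>v + s (y - v)\<close> for small \<open>s > 0\<close>,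
  convexity bounds \<open>R\<close> linearly in \<open>s\<close>, and the quadratic error of \<open>h\<close> is of order \<open>s\<^sup>2\<close>. Only an upper
  bound on \<open>h\<close> enters, so \<open>h\<close> may be concave.\<close>

lemma subgradient_if_minimizer_of_sum:
  fixes R h :: "'a::euclidean_space \<Rightarrow> real"
  assumes conv: "convex_on UNIV R"
    and upper: "\<And>z. h z \<le> h v + a \<bullet> (z - v) + C * (norm (z - v))\<^sup>2"
    and minimal: "\<And>z. h v + R v \<le> h z + R z"
  shows "- a \<in> subdifferential R v"
  unfolding subdifferential_def mem_Collect_eq
proof
  fix y
  define d where "d = y - v"
  have "R v - a \<bullet> d - R y \<le> s * (C * (norm d)\<^sup>2)" if s: "0 < s" "s < 1" for s :: real
  proof -
    have "R ((1 - s) *\<^sub>R v + s *\<^sub>R y) \<le> (1 - s) * R v + s * R y"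
      using s by (intro convex_onD[OF conv]) auto
    then have "R (v + s *\<^sub>R d) \<le> (1 - s) * R v + s * R y"
      by (simp add: d_def algebra_simps)
    moreover have "h (v + s *\<^sub>R d) \<le> h v + s * (a \<bullet> d) + C * (s\<^sup>2 * (norm d)\<^sup>2)"
      using upper[of "v + s *\<^sub>R d"] by (simp add: power_mult_distrib)
    ultimately have "s * (R v - a \<bullet> d - R y) \<le> s * (s * (C * (norm d)\<^sup>2))"
      using minimal[of "v + s *\<^sub>R d"] by (simp add: algebra_simps power2_eq_square)
    then show ?thesis
      using s by simp
  qed
  then have "\<forall>\<^sub>F s in at_right 0. R v - a \<bullet> d - R y \<le> s * (C * (norm d)\<^sup>2)"
    by (intro eventually_at_rightI[of 0 1]) auto
  moreover have "((\<lambda>s. s * (C * (norm d)\<^sup>2)) \<longlongrightarrow> 0 * (C * (norm d)\<^sup>2)) (at_right 0)"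
    by (intro tendsto_intros)
  ultimately have "R v - a \<bullet> d - R y \<le> 0 * (C * (norm d)\<^sup>2)"
    by (intro tendsto_lowerbound[of _ _ "at_right (0::real)"]) auto
  then show "R y \<ge> R v + - a \<bullet> (y - v)"
    by (simp add: d_def)
qed

text \<open>Every point minimizes \<open>- f + f = 0\<close>, and \<open>- f\<close> has a quadratic upper bound with slope \<open>- g x\<close>.\<close>

lemma gradient_in_subdifferential:
  fixes f :: "'a::euclidean_space \<Rightarrow> real"
  assumes conv: "convex_on UNIV f"
    and deriv: "\<And>z. GDERIV f z :> g z" and lip: "L-lipschitz_on UNIV g"
  shows "g x \<in> subdifferential f x"
proof -
  have "- (- g x) \<in> subdifferential f x"
  proof (rule subgradient_if_minimizer_of_sum[OF conv])
    show "- f z \<le> - f x + - g x \<bullet> (z - x) + L / 2 * (norm (z - x))\<^sup>2" for z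
      using quadratic_upper_bound_if_lipschitz_gradient[of "\<lambda>z. - f z" "\<lambda>z. - g z" L z x]
        deriv lip by (auto simp: lipschitz_on_def dist_norm norm_minus_commute intro: GDERIV_minus)
  qed simp
  then show ?thesis by simp
qed

text \<open>A gradient step of length \<open>1/L\<close> from \<open>y\<close> on the convex function \<open>z \<mapsto> f z - g x \<bullet> z\<close>, which is
  minimal at \<open>x\<close>, decreases it by the squared gradient norm over \<open>2 L\<close>.\<close>

lemma cocoercivity:
  fixes f :: "'a::euclidean_space \<Rightarrow> real"
  assumes conv: "convex_on UNIV f"
    and deriv: "\<And>z. GDERIV f z :> g z" and lip: "L-lipschitz_on UNIV g" and L: "L > 0"
  shows "(norm (g y - g x))\<^sup>2 \<le> 2 * L * (f y - f x - g x \<bullet> (y - x))"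
proof -
  define d where "d = g y - g x"
  define w where "w = y - (1 / L) *\<^sub>R d"
  have "f x + g x \<bullet> (w - x) \<le> f w"
    using gradient_in_subdifferential[OF conv deriv lip, of x] by (simp add: subdifferential_def)
  also have "\<dots> \<le> f y + g y \<bullet> (w - y) + L / 2 * (norm (w - y))\<^sup>2"
    by (rule quadratic_upper_bound_if_lipschitz_gradient[OF deriv lip])
  finally have "f x + g x \<bullet> (y - x) \<le> f y + d \<bullet> (w - y) + L / 2 * (norm (w - y))\<^sup>2"
    by (simp add: d_def inner_diff_left inner_diff_right)
  also have "\<dots> = f y - (norm d)\<^sup>2 / (2 * L)"
  proof -
    have "d \<bullet> (w - y) = - ((norm d)\<^sup>2 / L)"
      by (simp add: w_def dot_square_norm)
    moreover have "L / 2 * (norm (w - y))\<^sup>2 = (norm d)\<^sup>2 / (2 * L)"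
      using L by (simp add: w_def power_divide) (simp add: power2_eq_square)
    ultimately show ?thesis
      using L by (simp add: field_simps)
  qed
  finally show ?thesis
    using L by (simp add: d_def field_simps)
qed

text \<open>Optimality makes \<open>- (a + (c / \<tau>) (v - w))\<close> a subgradient of \<open>R\<close> at \<open>v\<close>, where strong convexity
  applies. The weight \<open>\<tau>\<close> is the number of iterations in a dual averaging model; at the start of a stage it is
  \<open>0\<close> and only the quadratic term is left.\<close>

lemma prox_growth:
  fixes R :: "'a::euclidean_space \<Rightarrow> real"
  assumes R: "strongly_convex \<mu> R" and \<tau>: "\<tau> \<ge> 0" and c: "c > 0"
    and minimal: "\<And>z. \<tau> * (a \<bullet> v + R v) + c / 2 * (norm (v - w))\<^sup>2
                     \<le> \<tau> * (a \<bullet> z + R z) + c / 2 * (norm (z - w))\<^sup>2"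
  shows "\<tau> * (a \<bullet> v + R v) + c / 2 * (norm (v - w))\<^sup>2 + (c + \<tau> * \<mu>) / 2 * (norm (z - v))\<^sup>2
         \<le> \<tau> * (a \<bullet> z + R z) + c / 2 * (norm (z - w))\<^sup>2"
proof -
  have expand: "c / 2 * (norm (z - w))\<^sup>2
      = c / 2 * (norm (v - w))\<^sup>2 + c * ((v - w) \<bullet> (z - v)) + c / 2 * (norm (z - v))\<^sup>2" for z
    by (simp add: power2_norm_eq_inner inner_diff_left inner_diff_right inner_commute algebra_simps)
  show ?thesis
  proof (cases "\<tau> = 0")
    case True
    then have "v = w"
      using minimal[of w] c by (simp add: mult_le_0_iff)
    then show ?thesis using True by simp
  next
    case False
    with \<tau> have pos: "\<tau> > 0" by simp
    define b where "b = a + (c / \<tau>) *\<^sub>R (v - w)"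
    have tb: "\<tau> * (b \<bullet> x) = \<tau> * (a \<bullet> x) + c * ((v - w) \<bullet> x)" for x
      using pos by (simp add: b_def inner_add_left algebra_simps)
    have "- b \<in> subdifferential R v"
    proof (rule subgradient_if_minimizer_of_sum)
      show "convex_on UNIV R"
        using R by (simp add: strongly_convex_def)
      fix z
      have e: "a \<bullet> z + c / (2 * \<tau>) * (norm (z - w))\<^sup>2
          = a \<bullet> v + c / (2 * \<tau>) * (norm (v - w))\<^sup>2 + b \<bullet> (z - v) + c / (2 * \<tau>) * (norm (z - v))\<^sup>2" for z
        using expand[of z] tb[of "z - v"] pos by (simp add: field_simps inner_diff_right)
      show "a \<bullet> z + c / (2 * \<tau>) * (norm (z - w))\<^sup>2
          \<le> a \<bullet> v + c / (2 * \<tau>) * (norm (v - w))\<^sup>2 + b \<bullet> (z - v) + c / (2 * \<tau>) * (norm (z - v))\<^sup>2"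
        using e[of z] by simp
      show "a \<bullet> v + c / (2 * \<tau>) * (norm (v - w))\<^sup>2 + R v
          \<le> a \<bullet> z + c / (2 * \<tau>) * (norm (z - w))\<^sup>2 + R z"
      proof -
        have "\<tau> * (a \<bullet> y + c / (2 * \<tau>) * (norm (y - w))\<^sup>2 + R y)
            = \<tau> * (a \<bullet> y + R y) + c / 2 * (norm (y - w))\<^sup>2" for y
          using pos by (simp add: field_simps)
        then show ?thesis
          using minimal[of z] pos by (metis mult_le_cancel_left_pos)
      qed
    qed
    then have "R v + - b \<bullet> (z - v) + \<mu> / 2 * (norm (z - v))\<^sup>2 \<le> R z"
      using R unfolding strongly_convex_def by blast
    then have "\<tau> * (R v + - b \<bullet> (z - v) + \<mu> / 2 * (norm (z - v))\<^sup>2) \<le> \<tau> * R z"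
      using pos by simp
    then show ?thesis
      using tb[of "z - v"] expand[of z]
      by (simp add: inner_diff_right algebra_simps add_divide_distrib)
  qed
qed

text \<open>A subgradient gives an affine minorant of \<open>R\<close>, so the quadratic term makes the objective coercive
  and the minimum over a large ball is global.\<close>

lemma prox_minimizer_exists:
  fixes R :: "'a::euclidean_space \<Rightarrow> real"
  assumes conv: "convex_on UNIV R" and sub: "\<xi> \<in> subdifferential R b" and c: "c > 0"
  shows "\<exists>v. is_arg_min (\<lambda>z. a \<bullet> z + R z + c * (norm (z - w))\<^sup>2) (\<lambda>_. True) v"
proof -
  define h where "h z = a \<bullet> z + R z + c * (norm (z - w))\<^sup>2" for z
  define k where "k = R b + \<xi> \<bullet> (w - b) + a \<bullet> w"
  define q where "q = norm (a + \<xi>)"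
  define \<rho> where "\<rho> = q / c + 1 + \<bar>h w - k\<bar> / c"
  have cont: "continuous_on UNIV h"
    unfolding h_def by (intro continuous_intros convex_on_continuous conv) auto
  have lower: "k - q * norm (z - w) + c * (norm (z - w))\<^sup>2 \<le> h z" for z
  proof -
    have "R b + \<xi> \<bullet> (z - b) \<le> R z"
      using sub by (simp add: subdifferential_def)
    moreover have "- ((a + \<xi>) \<bullet> (z - w)) \<le> q * norm (z - w)"
      using norm_cauchy_schwarz[of "- (a + \<xi>)" "z - w"] unfolding q_def by (simp only: norm_minus_cancel inner_minus_left)
    ultimately show ?thesis
      unfolding h_def k_def by (simp add: inner_add_left inner_diff_right)
  qed
  have outside: "h w \<le> h z" if "norm (z - w) > \<rho>" for z
  proof -
    define r where "r = norm (z - w)"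
    have "q + c + \<bar>h w - k\<bar> < c * r"
    proof -
      have "c * \<rho> = q + c + \<bar>h w - k\<bar>"
        using c by (simp add: \<rho>_def field_simps)
      moreover have "c * \<rho> < c * r"
        using that c by (simp add: r_def)
      ultimately show ?thesis by simp
    qed
    moreover have "q \<ge> 0"
      by (simp add: q_def)
    ultimately have "c * 1 < c * r" and r': "q + \<bar>h w - k\<bar> \<le> c * r"
      using c by linarith+
    then have r: "1 \<le> r" "q + \<bar>h w - k\<bar> \<le> c * r"
      using c by (simp_all add: mult_less_cancel_left_pos)
    have "\<bar>h w - k\<bar> \<le> (c * r - q) * 1"
      using r by simp
    also have "\<dots> \<le> (c * r - q) * r"
      using r by (intro mult_left_mono) auto
    finally show ?thesis
      using lower[of z] unfolding r_def[symmetric] by (simp add: algebra_simps power2_eq_square)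
  qed
  have "\<rho> \<ge> 0"
    using c by (simp add: \<rho>_def q_def)
  then have "cball w \<rho> \<noteq> {}" by simp
  then obtain v where v: "\<forall>z\<in>cball w \<rho>. h v \<le> h z"
    using continuous_attains_inf[OF compact_cball _ continuous_on_subset[OF cont subset_UNIV]]
    by blast
  have "h v \<le> h z" for z
  proof (cases "norm (z - w) \<le> \<rho>")
    case True then show ?thesis using v by (simp add: dist_norm norm_minus_commute)
  next
    case False then show ?thesis using v[rule_format, of w] outside[of z] \<open>\<rho> \<ge> 0\<close> by simp
  qed
  then show ?thesis
    by (auto simp: is_arg_min_linorder h_def)
qed

section \<open>Inequalities in inner product spaces\<close>

lemma sum_norm_diff_mean_le:
  fixes w :: "'i \<Rightarrow> 'a::real_inner"
  assumes "finite I" and mean: "real (card I) *\<^sub>R c = (\<Sum>i\<in>I. w i)"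
  shows "(\<Sum>i\<in>I. (norm (w i - c))\<^sup>2) \<le> (\<Sum>i\<in>I. (norm (w i))\<^sup>2)"
proof -
  have "(\<Sum>i\<in>I. (norm (w i - c))\<^sup>2)
      = (\<Sum>i\<in>I. (norm (w i))\<^sup>2) - 2 * ((\<Sum>i\<in>I. w i) \<bullet> c) + real (card I) * (norm c)\<^sup>2"
    by (simp add: power2_norm_eq_inner inner_diff_left inner_diff_right inner_commute
        sum.distrib sum_subtractf inner_sum_right algebra_simps flip: sum_distrib_left)
  also have "\<dots> = (\<Sum>i\<in>I. (norm (w i))\<^sup>2) - real (card I) * (norm c)\<^sup>2"
    by (simp flip: mean add: power2_norm_eq_inner)
  finally show ?thesis by simp
qed

lemma norm_diff_sq_le:
  fixes a b c :: "'a::real_inner"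
  shows "(norm (a - b))\<^sup>2 \<le> 2 * (norm (a - c))\<^sup>2 + 2 * (norm (b - c))\<^sup>2"
proof -
  have "0 \<le> (norm ((a - c) + (b - c)))\<^sup>2" by simp
  then show ?thesis
    by (simp add: power2_norm_eq_inner inner_diff_left inner_diff_right inner_add_left
        inner_add_right inner_commute)
qed

text \<open>Young's inequality, with the constant that the step size \<open>1 / (5 L t)\<close> provides.\<close>

lemma inner_minus_quadratic_le:
  fixes e d :: "'a::real_inner"
  assumes "L > 0"
  shows "e \<bullet> d - 2 * L * (norm d)\<^sup>2 \<le> (norm e)\<^sup>2 / (8 * L)"
proof -
  have "0 \<le> (norm (e - (4 * L) *\<^sub>R d))\<^sup>2" by simp
  also have "\<dots> = (norm e)\<^sup>2 - 8 * L * (e \<bullet> d - 2 * L * (norm d)\<^sup>2)"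
    unfolding power2_norm_eq_inner
    by (simp add: inner_diff_left inner_diff_right inner_commute algebra_simps power2_eq_square)
  finally show ?thesis
    using assms by (simp add: field_simps)
qed

section \<open>The composite problem\<close>

locale composite_problem =
  fixes n :: nat and f :: "nat \<Rightarrow> 'a::euclidean_space \<Rightarrow> real" and R P :: "'a \<Rightarrow> real"
    and L \<mu> :: real and xstar :: 'a
  assumes n: "n \<ge> 1"
    and f_convex: "\<And>i. i \<in> {1..n} \<Longrightarrow> convex_on UNIV (f i)"
    and f_differentiable: "\<And>i x. i \<in> {1..n} \<Longrightarrow> f i differentiable (at x)"
    and f_smooth: "\<And>i. i \<in> {1..n} \<Longrightarrow> L-lipschitz_on UNIV (gradient (f i))"
    and L: "L > 0"
    and mu: "\<mu> \<ge> 0"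
    and R: "strongly_convex \<mu> R"
    and P: "P = (\<lambda>x. (1 / real n) * (\<Sum>i = 1..n. f i x) + R x)"
    and xstar_minimal: "\<And>z. P xstar \<le> P z"
begin

definition F :: "'a \<Rightarrow> real" where
  "F x = (1 / real n) * (\<Sum>i = 1..n. f i x)"

definition grad_F :: "'a \<Rightarrow> 'a" where
  "grad_F x = (1 / real n) *\<^sub>R (\<Sum>i = 1..n. gradient (f i) x)"

text \<open>For \<open>\<phi>\<close> the table of reference points this governs the variance of the gradient estimate;
  for constant \<open>\<phi>\<close> co-coercivity bounds it by a Bregman divergence of \<open>F\<close>.\<close>

definition grad_dist_sq :: "(nat \<Rightarrow> 'a) \<Rightarrow> real" where
  "grad_dist_sq \<phi> = (\<Sum>i = 1..n. (norm (gradient (f i) (\<phi> i) - gradient (f i) xstar))\<^sup>2)"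

lemma grad_dist_sq_nonneg: "grad_dist_sq \<phi> \<ge> 0"
  by (simp add: grad_dist_sq_def sum_nonneg)

lemma P_eq: "P x = F x + R x"
  by (simp add: P F_def)

lemma R_convex: "convex_on UNIV R"
  using R by (simp add: strongly_convex_def)

lemma n_mult_F: "real n * F x = (\<Sum>i = 1..n. f i x)"
  using n by (simp add: F_def)

lemma sum_gradient: "(\<Sum>i = 1..n. gradient (f i) x) = real n *\<^sub>R grad_F x"
  using n by (simp add: grad_F_def)

lemma f_gradient: "i \<in> {1..n} \<Longrightarrow> GDERIV (f i) x :> gradient (f i) x"
  by (intro GDERIV_gradient f_differentiable)

lemma n_mult_grad_F_inner: "real n * (grad_F x \<bullet> z) = (\<Sum>i = 1..n. gradient (f i) x \<bullet> z)"
  by (metis inner_scaleR_left inner_sum_left sum_gradient)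

lemma F_quadratic_upper_bound:
  "F z \<le> F x + grad_F x \<bullet> (z - x) + L / 2 * (norm (z - x))\<^sup>2"
proof -
  have "(\<Sum>i = 1..n. f i z)
      \<le> (\<Sum>i = 1..n. f i x + gradient (f i) x \<bullet> (z - x) + L / 2 * (norm (z - x))\<^sup>2)"
    by (intro sum_mono quadratic_upper_bound_if_lipschitz_gradient f_gradient f_smooth)
  also have "\<dots> = real n * (F x + grad_F x \<bullet> (z - x) + L / 2 * (norm (z - x))\<^sup>2)"
    by (simp add: sum.distrib n_mult_F n_mult_grad_F_inner distrib_left)
  finally show ?thesis
    using n by (simp flip: n_mult_F)
qed

lemma F_cocoercivity:
  "(\<Sum>i = 1..n. (norm (gradient (f i) y - gradient (f i) x))\<^sup>2)
    \<le> 2 * L * real n * (F y - F x - grad_F x \<bullet> (y - x))"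
proof -
  have "(\<Sum>i = 1..n. (norm (gradient (f i) y - gradient (f i) x))\<^sup>2)
      \<le> (\<Sum>i = 1..n. 2 * L * (f i y - f i x - gradient (f i) x \<bullet> (y - x)))"
    by (intro sum_mono cocoercivity f_gradient f_smooth f_convex L)
  also have "\<dots> = 2 * L * (real n * F y - real n * F x - real n * (grad_F x \<bullet> (y - x)))"
    by (simp add: n_mult_F n_mult_grad_F_inner sum_subtractf flip: sum_distrib_left)
  finally show ?thesis
    by (simp add: algebra_simps)
qed

lemma F_gradient_inequality: "F x + grad_F x \<bullet> (y - x) \<le> F y"
proof -
  have "0 \<le> 2 * L * real n * (F y - F x - grad_F x \<bullet> (y - x))"
    by (rule order_trans[OF _ F_cocoercivity]) (simp add: sum_nonneg)
  then show ?thesis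
    using n L by (auto simp: zero_le_mult_iff mult_le_0_iff)
qed

lemma subgradient_at_xstar: "- grad_F xstar \<in> subdifferential R xstar"
  using subgradient_if_minimizer_of_sum[OF R_convex F_quadratic_upper_bound] xstar_minimal
  by (simp add: P_eq)

text \<open>The strong convexity inequality of \<open>R\<close> at \<open>xstar\<close>, for the subgradient \<open>- grad_F xstar\<close> that
  optimality provides.\<close>

lemma bregman_le_gap:
  "F y - F xstar - grad_F xstar \<bullet> (y - xstar) + \<mu> / 2 * (norm (y - xstar))\<^sup>2 \<le> P y - P xstar"
proof -
  have "R xstar + - grad_F xstar \<bullet> (y - xstar) + \<mu> / 2 * (norm (y - xstar))\<^sup>2 \<le> R y"
    using R subgradient_at_xstar unfolding strongly_convex_def by blast
  then show ?thesis
    by (simp add: P_eq)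
qed

section \<open>One inner iteration\<close>

definition estimate :: "'a sada_state \<Rightarrow> nat \<Rightarrow> 'a" where
  "estimate S i = gradient (f i) (st_u S) - gradient (f i) (st_phi S i)
     + (1 / real n) *\<^sub>R (\<Sum>j = 1..n. gradient (f j) (st_phi S j))"

lemma sum_estimate: "(\<Sum>i = 1..n. estimate S i) = real n *\<^sub>R grad_F (st_u S)"
  using n by (simp add: estimate_def sum.distrib sum_subtractf sum_gradient sum_constant_scaleR)

text \<open>The estimate is \<open>\<nabla>f\<^sub>i(u) - \<nabla>f\<^sub>i(\<phi>\<^sub>i)\<close>, recentred to have mean \<open>\<nabla>F(u)\<close>. Its variance is therefore at most the
  second moment of these differences, each of which is split at \<open>\<nabla>f\<^sub>i(x\<^sub>*)\<close>.\<close>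

lemma sum_estimate_error:
  "(\<Sum>i = 1..n. (norm (grad_F (st_u S) - estimate S i))\<^sup>2)
    \<le> 2 * grad_dist_sq (\<lambda>_. st_u S) + 2 * grad_dist_sq (st_phi S)"
proof -
  define w where "w i = gradient (f i) (st_u S) - gradient (f i) (st_phi S i)" for i
  define c where "c = grad_F (st_u S) - (1 / real n) *\<^sub>R (\<Sum>j = 1..n. gradient (f j) (st_phi S j))"
  have "real (card {1..n}) *\<^sub>R c = (\<Sum>i = 1..n. w i)"
    using n by (simp add: c_def w_def sum_subtractf sum_gradient scaleR_diff_right)
  then have "(\<Sum>i = 1..n. (norm (w i - c))\<^sup>2) \<le> (\<Sum>i = 1..n. (norm (w i))\<^sup>2)"
    by (intro sum_norm_diff_mean_le) auto
  moreover have "norm (grad_F (st_u S) - estimate S i) = norm (w i - c)" for i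
    unfolding estimate_def c_def w_def
    by (subst norm_minus_commute) (simp add: algebra_simps)
  moreover have "(\<Sum>i = 1..n. (norm (w i))\<^sup>2)
      \<le> 2 * grad_dist_sq (\<lambda>_. st_u S) + 2 * grad_dist_sq (st_phi S)"
    unfolding w_def grad_dist_sq_def sum_distrib_left sum.distrib[symmetric]
    by (intro sum_mono norm_diff_sq_le)
  ultimately show ?thesis by simp
qed

text \<open>The objective minimized by \<open>st_v\<close>, scaled by \<open>t\<close>: in this scaling an iteration just adds a linear
  term and a copy of \<open>R\<close>, and at \<open>t = 0\<close> the objective makes sense as well.\<close>

definition model :: "'a \<Rightarrow> nat \<Rightarrow> 'a sada_state \<Rightarrow> 'a \<Rightarrow> real" where
  "model v0 t S z = real t * (st_gbar S \<bullet> z + R z) + 5 * L / 2 * (norm (z - v0))\<^sup>2"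

text \<open>The facts about a state that the analysis of the next iteration uses; they hold for every sequence
  of draws.\<close>

definition valid_state :: "'a \<Rightarrow> nat \<Rightarrow> 'a sada_state \<Rightarrow> bool" where
  "valid_state v0 t S \<longleftrightarrow>
     st_u S = (1 - 1 / real (t + 1)) *\<^sub>R st_x S + (1 / real (t + 1)) *\<^sub>R st_v S \<and>
     (\<forall>z. model v0 t S (st_v S) \<le> model v0 t S z)"

lemma valid_state_init: "valid_state v0 0 (sada_init x0 v0)"
  by (simp add: valid_state_def sada_init_def model_def L less_imp_le)

lemma arg_min_prox:
  assumes "c > 0" and v: "v = (ARG_MIN (\<lambda>z. a \<bullet> z + R z + c * (norm (z - w))\<^sup>2) z. True)"
  shows "a \<bullet> v + R v + c * (norm (v - w))\<^sup>2 \<le> a \<bullet> z + R z + c * (norm (z - w))\<^sup>2"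
proof -
  have "is_arg_min (\<lambda>z. a \<bullet> z + R z + c * (norm (z - w))\<^sup>2) (\<lambda>_. True) v"
    unfolding v arg_min_def
    by (rule someI_ex) (rule prox_minimizer_exists[OF R_convex subgradient_at_xstar assms(1)])
  then show ?thesis
    by (simp add: is_arg_min_linorder)
qed

context
  fixes v0 :: 'a and t i :: nat and S S' :: "'a sada_state"
  assumes S': "S' = sada_step n f R (5 * L) v0 (Suc t) i S"
begin

lemma step_gbar: "real (Suc t) *\<^sub>R st_gbar S' = real t *\<^sub>R st_gbar S + estimate S i"
proof -
  have "st_gbar S' = (1 - 1 / real (Suc t)) *\<^sub>R st_gbar S + (1 / real (Suc t)) *\<^sub>R estimate S i"
    by (simp add: S' sada_step_def Let_def estimate_def)
  moreover have "real (Suc t) * (1 - 1 / real (Suc t)) = real t"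
    by (simp add: field_simps)
  ultimately show ?thesis
    by (simp add: scaleR_add_right del: of_nat_Suc)
qed

lemma step_phi: "st_phi S' = (st_phi S)(i := st_u S)"
  by (simp add: S' sada_step_def Let_def)

lemma step_model: "model v0 (Suc t) S' z = model v0 t S z + estimate S i \<bullet> z + R z"
proof -
  have "real (Suc t) * (st_gbar S' \<bullet> z) = real t * (st_gbar S \<bullet> z) + estimate S i \<bullet> z"
    by (metis inner_add_left inner_scaleR_left step_gbar)
  then show ?thesis
    by (simp add: model_def distrib_left distrib_right)
qed

lemma step_x_minimal:
  "estimate S i \<bullet> st_x S' + R (st_x S') + 5 * L * real (Suc t) / 2 * (norm (st_x S' - st_u S))\<^sup>2
    \<le> estimate S i \<bullet> z + R z + 5 * L * real (Suc t) / 2 * (norm (z - st_u S))\<^sup>2"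
  by (rule arg_min_prox) (use L in \<open>auto simp: S' sada_step_def Let_def estimate_def\<close>)

lemma step_v_minimal: "model v0 (Suc t) S' (st_v S') \<le> model v0 (Suc t) S' z"
proof -
  have "st_gbar S' \<bullet> st_v S' + R (st_v S')
          + 5 * L / (2 * real (Suc t)) * (norm (st_v S' - v0))\<^sup>2
      \<le> st_gbar S' \<bullet> z + R z + 5 * L / (2 * real (Suc t)) * (norm (z - v0))\<^sup>2"
    by (rule arg_min_prox) (use L in \<open>auto simp: S' sada_step_def Let_def\<close>)
  moreover have "model v0 (Suc t) S' y = real (Suc t) *
      (st_gbar S' \<bullet> y + R y + 5 * L / (2 * real (Suc t)) * (norm (y - v0))\<^sup>2)" for y
    unfolding model_def by (simp add: distrib_left del: of_nat_Suc)
  ultimately show ?thesis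
    by (metis mult_left_mono of_nat_0_le_iff)
qed

lemma valid_state_step: "valid_state v0 (Suc t) S'"
  unfolding valid_state_def using step_v_minimal by (simp add: S' sada_step_def Let_def)

end

section \<open>The potential of a stage\<close>

text \<open>The estimate sequence: \<open>t\<close> times the suboptimality of the primal iterate, corrected by how far the
  minimum of the model lies below its value at \<open>xstar\<close>. At \<open>t = 0\<close> it is \<open>5 L / 2\<close> times the squared distance
  of the starting point from \<open>xstar\<close>.\<close>

definition gap :: "'a \<Rightarrow> nat \<Rightarrow> 'a sada_state \<Rightarrow> real" where
  "gap v0 t S = real t * (P (st_x S) - P xstar) + model v0 t S xstar - model v0 t S (st_v S)"

text \<open>The proximal step defining \<open>st_x\<close> is compared with the point \<open>z\<close> that takes the place of \<open>u\<close> when the old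
  \<open>v\<close> in its definition is replaced by the new \<open>v'\<close>. Then \<open>z - u\<close> is proportional to \<open>v' - v\<close>, so the proximal
  penalty at \<open>z\<close> cancels against the growth of the old model between its minimizer \<open>v\<close> and \<open>v'\<close>.\<close>

lemma gap_step:
  assumes valid: "valid_state v0 t S" and S': "S' = sada_step n f R (5 * L) v0 (Suc t) i S"
  shows "gap v0 (Suc t) S' \<le> real (Suc t) * (F (st_u S) - P xstar)
      + estimate S i \<bullet> (real t *\<^sub>R st_x S + xstar - real (Suc t) *\<^sub>R st_u S)
      + real t * R (st_x S) + R xstar + model v0 t S xstar - model v0 t S (st_v S)
      + (norm (grad_F (st_u S) - estimate S i))\<^sup>2 / (8 * L)"
proof -
  define T where "T = real (Suc t)"
  define g u x v x' v' where
    "g = estimate S i" and "u = st_u S" and "x = st_x S" and "v = st_v S"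
    and "x' = st_x S'" and "v' = st_v S'"
  note defs = g_def u_def x_def v_def x'_def v'_def
  have T: "T \<ge> 1" "real t = T - 1" by (simp_all add: T_def)
  \<comment> \<open>\<open>u\<close> with the new \<open>v'\<close> in place of \<open>v\<close>\<close>
  define z where "z = (1 - 1 / T) *\<^sub>R x + (1 / T) *\<^sub>R v'"
  have u: "u = (1 - 1 / T) *\<^sub>R x + (1 / T) *\<^sub>R v"
    using valid by (simp add: valid_state_def defs T_def add.commute)
  have prox: "T * (g \<bullet> x' + R x') + 5 * L * T\<^sup>2 / 2 * (norm (x' - u))\<^sup>2
      \<le> (T - 1) * (g \<bullet> x + R x) + (g \<bullet> v' + R v') + 5 * L / 2 * (norm (v' - v))\<^sup>2"
  proof -
    have "R z \<le> (1 - 1 / T) * R x + 1 / T * R v'"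
      unfolding z_def using T by (intro convex_onD[OF R_convex]) auto
    then have Rz: "T * R z \<le> (T - 1) * R x + R v'"
      using T by (simp add: field_simps)
    have gz: "T * (g \<bullet> z) = (T - 1) * (g \<bullet> x) + g \<bullet> v'"
      using T by (simp add: z_def inner_add_right field_simps)
    have "z - u = (1 / T) *\<^sub>R (v' - v)"
      by (simp add: z_def u algebra_simps)
    then have zu: "T\<^sup>2 * (norm (z - u))\<^sup>2 = (norm (v' - v))\<^sup>2"
      using T by (simp add: power_mult_distrib power_divide)
    have "g \<bullet> x' + R x' + 5 * L * T / 2 * (norm (x' - u))\<^sup>2
        \<le> g \<bullet> z + R z + 5 * L * T / 2 * (norm (z - u))\<^sup>2"
      unfolding defs T_def by (rule step_x_minimal[OF S'])
    then have "T * (g \<bullet> x' + R x' + 5 * L * T / 2 * (norm (x' - u))\<^sup>2)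
        \<le> T * (g \<bullet> z + R z + 5 * L * T / 2 * (norm (z - u))\<^sup>2)"
      using T by (intro mult_left_mono) auto
    also have "\<dots> = T * (g \<bullet> z) + T * R z + 5 * L / 2 * (T\<^sup>2 * (norm (z - u))\<^sup>2)"
      by (simp add: algebra_simps power2_eq_square)
    finally show ?thesis
      using Rz unfolding zu gz by (simp add: algebra_simps power2_eq_square)
  qed
  have growth: "model v0 t S v + 5 * L / 2 * (norm (v' - v))\<^sup>2 \<le> model v0 t S v'"
  proof -
    have "model v0 t S v + (5 * L + real t * \<mu>) / 2 * (norm (v' - v))\<^sup>2 \<le> model v0 t S v'"
      using valid L unfolding model_def valid_state_def v_def
      by (intro prox_growth[OF R]) auto
    moreover have "5 * L / 2 * (norm (v' - v))\<^sup>2 \<le> (5 * L + real t * \<mu>) / 2 * (norm (v' - v))\<^sup>2"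
      using mu by (intro mult_right_mono) auto
    ultimately show ?thesis by linarith
  qed
  have descent: "T * F x' \<le> T * F u + T * (g \<bullet> (x' - u)) + 5 * L * T\<^sup>2 / 2 * (norm (x' - u))\<^sup>2
      + (norm (grad_F u - g))\<^sup>2 / (8 * L)"
  proof -
    have "T * F x' \<le> T * (F u + grad_F u \<bullet> (x' - u) + L / 2 * (norm (x' - u))\<^sup>2)"
      using T F_quadratic_upper_bound by (intro mult_left_mono) auto
    moreover have "L * (norm (x' - u))\<^sup>2 * T \<le> L * (norm (x' - u))\<^sup>2 * T\<^sup>2"
      using T L by (intro mult_left_mono self_le_power) auto
    moreover have "T * ((grad_F u - g) \<bullet> (x' - u)) - 2 * L * T\<^sup>2 * (norm (x' - u))\<^sup>2
        \<le> (norm (grad_F u - g))\<^sup>2 / (8 * L)"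
      using inner_minus_quadratic_le[OF L, of "grad_F u - g" "T *\<^sub>R (x' - u)"]
      by (simp add: power_mult_distrib mult_ac)
    ultimately show ?thesis
      by (simp add: inner_diff_left algebra_simps)
  qed
  have "gap v0 (Suc t) S' = T * F x' + T * R x' - T * P xstar
      + model v0 t S xstar + g \<bullet> xstar + R xstar - model v0 t S v' - g \<bullet> v' - R v'"
    unfolding gap_def step_model[OF S'] by (simp add: P_eq defs T_def algebra_simps)
  then show ?thesis
    using prox growth descent
    unfolding defs[symmetric] T_def[symmetric] T(2)
    by (simp add: inner_diff_right inner_add_right algebra_simps)
qed

text \<open>On average the estimate is \<open>\<nabla>F(u)\<close>, which turns the bound of \<open>gap_step\<close> into
  gradient inequalities for \<open>F\<close> at \<open>u\<close>, towards \<open>x\<close> and towards \<open>xstar\<close>. In the latter the Bregman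
  divergence is kept, and half of it pays for the part of the variance at \<open>u\<close>.\<close>

lemma sum_gap_step:
  assumes valid: "valid_state v0 t S"
  shows "(\<Sum>i = 1..n. gap v0 (Suc t) (sada_step n f R (5 * L) v0 (Suc t) i S))
    \<le> real n * gap v0 t S + (grad_dist_sq (st_phi S) - grad_dist_sq (\<lambda>_. st_u S)) / (4 * L)"
proof -
  define u x where "u = st_u S" and "x = st_x S"
  define y where "y = real t *\<^sub>R x + xstar - real (Suc t) *\<^sub>R u"
  define K where "K = real (Suc t) * (F u - P xstar) + real t * R x + R xstar
      + model v0 t S xstar - model v0 t S (st_v S)"
  have est: "(\<Sum>i = 1..n. estimate S i \<bullet> y) = real n * (grad_F u \<bullet> y)"
    by (simp add: sum_estimate u_def flip: inner_sum_left)
  have "(\<Sum>i = 1..n. gap v0 (Suc t) (sada_step n f R (5 * L) v0 (Suc t) i S))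
      \<le> (\<Sum>i = 1..n. K + estimate S i \<bullet> y + (norm (grad_F u - estimate S i))\<^sup>2 / (8 * L))"
    using gap_step[OF valid refl] unfolding K_def y_def u_def x_def
    by (intro sum_mono) (simp add: algebra_simps)
  also have "\<dots> = real n * (K + grad_F u \<bullet> y)
      + (\<Sum>i = 1..n. (norm (grad_F u - estimate S i))\<^sup>2) / (8 * L)"
    by (simp add: sum.distrib est distrib_left flip: sum_divide_distrib)
  also have "\<dots> \<le> real n * (K + grad_F u \<bullet> y)
      + (2 * grad_dist_sq (\<lambda>_. u) + 2 * grad_dist_sq (st_phi S)) / (8 * L)"
    using sum_estimate_error[of S] L unfolding u_def by (intro add_left_mono divide_right_mono) auto
  also have "(2 * grad_dist_sq (\<lambda>_. u) + 2 * grad_dist_sq (st_phi S)) / (8 * L)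
      = (grad_dist_sq (\<lambda>_. u) + grad_dist_sq (st_phi S)) / (4 * L)"
    using L by (simp add: field_simps)
  finally have sum_le: "(\<Sum>i = 1..n. gap v0 (Suc t) (sada_step n f R (5 * L) v0 (Suc t) i S))
      \<le> real n * (K + grad_F u \<bullet> y) + (grad_dist_sq (\<lambda>_. u) + grad_dist_sq (st_phi S)) / (4 * L)" .
  have "real t * (F u + grad_F u \<bullet> (x - u)) \<le> real t * F x"
    by (intro mult_left_mono F_gradient_inequality) simp
  then have "K + grad_F u \<bullet> y \<le> gap v0 t S - (F xstar - F u - grad_F u \<bullet> (xstar - u))"
    unfolding K_def y_def gap_def x_def[symmetric]
    by (simp add: P_eq inner_diff_right inner_add_right algebra_simps)
  then have "real n * (K + grad_F u \<bullet> y)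
      \<le> real n * gap v0 t S - real n * (F xstar - F u - grad_F u \<bullet> (xstar - u))"
    by (metis mult_left_mono of_nat_0_le_iff right_diff_distrib)
  moreover have "grad_dist_sq (\<lambda>_. u) / (2 * L) \<le> real n * (F xstar - F u - grad_F u \<bullet> (xstar - u))"
    using F_cocoercivity[of xstar u] L
    by (simp add: grad_dist_sq_def norm_minus_commute field_simps)
  ultimately have "real n * (K + grad_F u \<bullet> y) \<le> real n * gap v0 t S - grad_dist_sq (\<lambda>_. u) / (2 * L)"
    by linarith
  with sum_le show ?thesis
    unfolding u_def[symmetric] using L by (simp add: field_simps)
qed

lemma sum_grad_dist_sq_update:
  "(\<Sum>i = 1..n. grad_dist_sq (\<phi>(i := u)))
    = (real n - 1) * grad_dist_sq \<phi> + grad_dist_sq (\<lambda>_. u)"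
proof -
  define d where "d i x = (norm (gradient (f i) x - gradient (f i) xstar))\<^sup>2" for i x
  have upd: "grad_dist_sq (\<phi>(i := u)) = grad_dist_sq \<phi> + (d i u - d i (\<phi> i))" if "i \<in> {1..n}" for i
  proof -
    have "(\<Sum>j \<in> {1..n} - {i}. d j ((\<phi>(i := u)) j)) = (\<Sum>j \<in> {1..n} - {i}. d j (\<phi> j))"
      by (intro sum.cong) auto
    then show ?thesis
      using that unfolding grad_dist_sq_def d_def[symmetric]
      by (simp add: sum.remove[of "{1..n}" i])
  qed
  have "(\<Sum>i = 1..n. grad_dist_sq (\<phi>(i := u)))
      = (\<Sum>i = 1..n. grad_dist_sq \<phi> + (d i u - d i (\<phi> i)))"
    by (intro sum.cong upd) auto
  also have "\<dots> = real n * grad_dist_sq \<phi> + (grad_dist_sq (\<lambda>_. u) - grad_dist_sq \<phi>)"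
    by (simp add: sum.distrib sum_subtractf grad_dist_sq_def d_def)
  finally show ?thesis
    by (simp add: algebra_simps)
qed

text \<open>An outdated reference point inflates the variance of the remaining \<open>m - t\<close> iterations, but on average
  only until it is replaced, which takes \<open>n\<close> iterations; hence the weight \<open>min n (m - t)\<close>.\<close>

definition potential :: "nat \<Rightarrow> 'a \<Rightarrow> nat \<Rightarrow> 'a sada_state \<Rightarrow> real" where
  "potential m v0 t S
     = gap v0 t S + real (min n (m - t)) / (4 * L * real n) * grad_dist_sq (st_phi S)"

lemma sum_potential_step:
  assumes valid: "valid_state v0 t S" and t: "t < m"
  shows "(\<Sum>i = 1..n. potential m v0 (Suc t) (sada_step n f R (5 * L) v0 (Suc t) i S))
    \<le> real n * potential m v0 t S"
proof -
  define N where "N = real n"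
  define c c' where "c = real (min n (m - t))" and "c' = real (min n (m - Suc t))"
  define H G where "H = grad_dist_sq (st_phi S)" and "G = grad_dist_sq (\<lambda>_. st_u S)"
  have N: "N \<ge> 1" using n by (simp add: N_def)
  have c: "c' \<le> N" "N + c' * (N - 1) \<le> N * c"
  proof -
    show "c' \<le> N" by (simp add: N_def c'_def)
    show "N + c' * (N - 1) \<le> N * c"
    proof (cases "m - t \<le> n")
      case True
      then have "c = c' + 1" "c' \<ge> 0" using t by (auto simp: c_def c'_def)
      then show ?thesis by (simp add: algebra_simps)
    next
      case False
      then have "c = N" "c' = N" by (auto simp: c_def c'_def N_def)
      then show ?thesis by (simp add: algebra_simps)
    qed
  qed
  have HG: "H \<ge> 0" "G \<ge> 0" by (simp_all add: H_def G_def grad_dist_sq_nonneg)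
  have "(\<Sum>i = 1..n. grad_dist_sq (st_phi (sada_step n f R (5 * L) v0 (Suc t) i S)))
      = (N - 1) * H + G"
    by (simp add: step_phi[OF refl] sum_grad_dist_sq_update N_def H_def G_def)
  then have "(\<Sum>i = 1..n. potential m v0 (Suc t) (sada_step n f R (5 * L) v0 (Suc t) i S))
      = (\<Sum>i = 1..n. gap v0 (Suc t) (sada_step n f R (5 * L) v0 (Suc t) i S))
        + c' / (4 * L * N) * ((N - 1) * H + G)"
    unfolding potential_def c'_def[symmetric] N_def[symmetric]
    by (simp only: sum.distrib sum_distrib_left[symmetric])
  also have "\<dots> \<le> N * gap v0 t S + (H - G) / (4 * L) + c' / (4 * L * N) * ((N - 1) * H + G)"
    using sum_gap_step[OF valid] by (simp add: N_def H_def G_def)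
  finally have "(\<Sum>i = 1..n. potential m v0 (Suc t) (sada_step n f R (5 * L) v0 (Suc t) i S))
      \<le> N * gap v0 t S + ((H - G) / (4 * L) + c' / (4 * L * N) * ((N - 1) * H + G))"
    by simp
  moreover have "(H - G) / (4 * L) + c' / (4 * L * N) * ((N - 1) * H + G) \<le> c / (4 * L) * H"
  proof -
    \<comment> \<open>multiplied by \<open>4 L N\<close>, the claim compares the coefficients of \<open>H\<close> and of \<open>G\<close>\<close>
    have "(N + c' * (N - 1)) * H + c' * G \<le> N * c * H + N * G"
      using c HG by (intro add_mono mult_right_mono)
    then have "(N * H - N * G + c' * ((N - 1) * H + G)) / (4 * L * N) \<le> N * c * H / (4 * L * N)"
      using L N by (intro divide_right_mono) (auto simp: algebra_simps)
    moreover have "(H - G) / (4 * L) + c' / (4 * L * N) * ((N - 1) * H + G)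
        = (N * H - N * G + c' * ((N - 1) * H + G)) / (4 * L * N)"
      using L N by (simp add: field_simps)
    moreover have "c / (4 * L) * H = N * c * H / (4 * L * N)"
      using N by simp
    ultimately show ?thesis by simp
  qed
  moreover have "N * potential m v0 t S = N * gap v0 t S + c / (4 * L) * H"
    using N unfolding potential_def c_def[symmetric] H_def[symmetric] N_def[symmetric]
    by (simp add: distrib_left)
  ultimately show ?thesis
    unfolding N_def[symmetric] by linarith
qed

text \<open>At \<open>t = 0\<close> all reference points are \<open>x0\<close>, so co-coercivity bounds the table term by the Bregman divergence
  between \<open>x0\<close> and \<open>xstar\<close>, with weight \<open>min n m \<le> m\<close>.\<close>

lemma potential_init_le:
  "potential m v0 0 (sada_init x0 v0)
    \<le> 5 * L / 2 * (norm (xstar - v0))\<^sup>2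
      + real m / 2 * (P x0 - P xstar - \<mu> / 2 * (norm (x0 - xstar))\<^sup>2)"
proof -
  define D where "D = F x0 - F xstar - grad_F xstar \<bullet> (x0 - xstar)"
  have D: "D \<ge> 0" "D \<le> P x0 - P xstar - \<mu> / 2 * (norm (x0 - xstar))\<^sup>2"
    using F_gradient_inequality[of xstar x0] bregman_le_gap[of x0] by (auto simp: D_def)
  have "real (min n m) / (4 * L * real n) * grad_dist_sq (\<lambda>_. x0)
      \<le> real (min n m) / (4 * L * real n) * (2 * L * real n * D)"
    using F_cocoercivity[of x0 xstar] L by (intro mult_left_mono) (auto simp: grad_dist_sq_def D_def)
  also have "\<dots> = real (min n m) / 2 * D"
    using L n by (simp add: field_simps)
  also have "\<dots> \<le> real m / 2 * D"
    using D by (intro mult_right_mono) auto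
  also have "\<dots> \<le> real m / 2 * (P x0 - P xstar - \<mu> / 2 * (norm (x0 - xstar))\<^sup>2)"
    using D by (intro mult_left_mono) auto
  finally show ?thesis
    by (simp add: potential_def gap_def model_def sada_init_def)
qed

lemma potential_final_ge:
  assumes valid: "valid_state v0 m S"
  shows "real m * (P (st_x S) - P xstar) + (5 * L + real m * \<mu>) / 2 * (norm (st_v S - xstar))\<^sup>2
    \<le> potential m v0 m S"
proof -
  have "model v0 m S (st_v S) + (5 * L + real m * \<mu>) / 2 * (norm (xstar - st_v S))\<^sup>2
      \<le> model v0 m S xstar"
    using valid L unfolding model_def valid_state_def by (intro prox_growth[OF R]) auto
  then show ?thesis
    by (simp add: potential_def gap_def norm_minus_commute)
qed

lemma valid_state_inner: "valid_state v0 t (sada_inner n f R (5 * L) x0 v0 i t)"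
  by (induction t) (simp_all add: valid_state_init valid_state_step[OF refl])

end

section \<open>Averages over the draws\<close>

text \<open>The discrete form of conditioning on all draws but the one with index \<open>j\<close>, which is uniform
  on \<open>B\<close> and independent of the others.\<close>

lemma sum_PiE_resample:
  fixes h :: "('i \<Rightarrow> 'b) \<Rightarrow> real"
  assumes j: "j \<in> J"
  shows "(\<Sum>w\<in>PiE J (\<lambda>_. B). \<Sum>b\<in>B. h (w(j := b)))
       = real (card B) * (\<Sum>w\<in>PiE J (\<lambda>_. B). h w)"
proof -
  define K where "K = PiE (J - {j}) (\<lambda>_. B)"
  have split: "(\<Sum>w\<in>PiE J (\<lambda>_. B). H w) = (\<Sum>b\<in>B. \<Sum>w\<in>K. H (w(j := b)))" for H :: "('i \<Rightarrow> 'b) \<Rightarrow> real"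
  proof -
    have "J = insert j (J - {j})" using j by blast
    then have image: "PiE J (\<lambda>_. B) = (\<lambda>(b, w). w(j := b)) ` (B \<times> K)"
      unfolding K_def using PiE_insert_eq[of j "J - {j}" "\<lambda>_. B"] by simp
    have "inj_on (\<lambda>(b, w). w(j := b)) (B \<times> K)"
      unfolding K_def by (intro inj_combinator) simp
    then have "(\<Sum>w\<in>PiE J (\<lambda>_. B). H w) = (\<Sum>(b, w)\<in>B \<times> K. H (w(j := b)))"
      unfolding image by (subst sum.reindex) (simp_all add: case_prod_beta comp_def)
    then show ?thesis
      by (simp add: sum.cartesian_product)
  qed
  show ?thesis
    unfolding split by (simp add: sum.swap[of _ K])
qed

text \<open>The draws indexed by \<open>J\<close> are almost surely in \<open>B\<close>, and independence gives every sequence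
  in \<open>B\<close> the same probability. The draws may leave \<open>B\<close> on a null set; since they take countably
  many values, \<open>h\<close> of the draws is measurable there as well.\<close>

lemma (in prob_space) expectation_uniform_draws:
  fixes X :: "'i \<Rightarrow> 'a \<Rightarrow> 'b::countable" and h :: "('i \<Rightarrow> 'b) \<Rightarrow> real"
  assumes indep: "indep_vars (\<lambda>_. count_space UNIV) X J" and J: "finite J"
    and B: "finite B" "B \<noteq> {}"
    and unif: "\<And>j. j \<in> J \<Longrightarrow> distr M (count_space UNIV) (X j) = measure_pmf (pmf_of_set B)"
  shows "expectation (\<lambda>w. h (\<lambda>j\<in>J. X j w))
       = (\<Sum>x\<in>PiE J (\<lambda>_. B). h x) / real (card B) ^ card J"
proof -
  define E where "E x = {w \<in> space M. \<forall>j\<in>J. X j w = x j}" for x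
  have X [measurable]: "X j \<in> measurable M (count_space UNIV)" if "j \<in> J" for j
    using indep that unfolding indep_vars_def by auto
  have E [measurable]: "E x \<in> events" for x
    unfolding E_def using J by measurable
  have prob_E: "prob (E x) = 1 / real (card B) ^ card J" if x: "x \<in> PiE J (\<lambda>_. B)" for x
  proof (cases "J = {}")
    case True
    then show ?thesis by (simp add: E_def prob_space)
  next
    case False
    have "prob (X j -` {x j} \<inter> space M) = 1 / real (card B)" if "j \<in> J" for j
    proof -
      have "prob (X j -` {x j} \<inter> space M) = measure (distr M (count_space UNIV) (X j)) {x j}"
        using that by (subst measure_distr) auto
      also have "\<dots> = 1 / real (card B)"
        using that PiE_mem[OF x that] B by (simp add: unif measure_pmf_single)
      finally show ?thesis .
    qed
    then have "prob (\<Inter>j\<in>J. X j -` {x j} \<inter> space M) = (1 / real (card B)) ^ card J"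
      using indep_varsD_finite[OF indep False J, of "\<lambda>j. {x j}"] by simp
    moreover have "(\<Inter>j\<in>J. X j -` {x j} \<inter> space M) = E x"
      using False by (auto simp: E_def)
    ultimately show ?thesis by (simp add: power_divide)
  qed
  have "AE w in M. \<forall>j\<in>J. X j w \<in> B"
  proof (rule AE_finite_allI[OF J])
    fix j assume j: "j \<in> J"
    have "AE b in distr M (count_space UNIV) (X j). b \<in> B"
      unfolding unif[OF j] using B by (simp add: AE_measure_pmf_iff)
    then show "AE w in M. X j w \<in> B"
      by (rule AE_distrD[OF X[OF j]])
  qed
  with AE_space have eq: "AE w in M. h (\<lambda>j\<in>J. X j w) = (\<Sum>x\<in>PiE J (\<lambda>_. B). h x * indicator (E x) w)"
  proof eventually_elim
    case (elim w)
    define y where "y = (\<lambda>j\<in>J. X j w)"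
    have y: "y \<in> PiE J (\<lambda>_. B)"
      using elim by (auto simp: y_def)
    have "indicator (E x) w = (if y = x then 1 else 0 :: real)" if "x \<in> PiE J (\<lambda>_. B)" for x
    proof -
      have "y = x \<longleftrightarrow> (\<forall>j\<in>J. y j = x j)"
        using y that by (metis PiE_ext)
      then show ?thesis
        using elim by (auto simp: E_def y_def)
    qed
    then have "(\<Sum>x\<in>PiE J (\<lambda>_. B). h x * indicator (E x) w)
        = (\<Sum>x\<in>PiE J (\<lambda>_. B). if y = x then h x else 0)"
      by (intro sum.cong) auto
    also have "\<dots> = h y"
      using y J B by (simp add: finite_PiE)
    finally show ?case
      by (simp add: y_def)
  qed
  have meas: "(\<lambda>w. h (\<lambda>j\<in>J. X j w)) \<in> borel_measurable M"
  proof -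
    have "(\<lambda>w. \<lambda>j\<in>J. X j w) \<in> measurable M (PiM J (\<lambda>_. count_space UNIV))"
      by measurable
    then have "(\<lambda>w. \<lambda>j\<in>J. X j w) \<in> measurable M (count_space (PiE J (\<lambda>_. UNIV)))"
      using count_space_PiM_finite[OF J, of "\<lambda>_. UNIV :: 'b set"] by simp
    then show ?thesis
      by (rule measurable_compose) simp
  qed
  have "expectation (\<lambda>w. h (\<lambda>j\<in>J. X j w))
      = expectation (\<lambda>w. \<Sum>x\<in>PiE J (\<lambda>_. B). h x * indicator (E x) w)"
    by (intro integral_cong_AE eq meas) measurable
  also have "\<dots> = (\<Sum>x\<in>PiE J (\<lambda>_. B). h x * prob (E x))"
    by (subst Bochner_Integration.integral_sum) (auto simp: E emeasure_eq_measure)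
  also have "\<dots> = (\<Sum>x\<in>PiE J (\<lambda>_. B). h x) / real (card B) ^ card J"
    by (simp add: prob_E sum_divide_distrib)
  finally show ?thesis .
qed

lemma sada_inner_cong:
  assumes "\<And>k. 1 \<le> k \<Longrightarrow> k \<le> t \<Longrightarrow> i k = i' k"
  shows "sada_inner n f R \<eta> x0 v0 i t = sada_inner n f R \<eta> x0 v0 i' t"
  using assms by (induction t) auto

lemma sada_cong:
  assumes "\<And>r t. 1 \<le> r \<Longrightarrow> r \<le> s \<Longrightarrow> 1 \<le> t \<Longrightarrow> t \<le> sada_stage_length \<mu> m\<^sub>1 r \<Longrightarrow> i r t = i' r t"
  shows "sada n f R \<mu> \<eta> m\<^sub>1 \<alpha> xinit i s = sada n f R \<mu> \<eta> m\<^sub>1 \<alpha> xinit i' s"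
  using assms
proof (induction s)
  case (Suc s)
  have "sada n f R \<mu> \<eta> m\<^sub>1 \<alpha> xinit i s = sada n f R \<mu> \<eta> m\<^sub>1 \<alpha> xinit i' s"
    using Suc by simp
  moreover have "sada_inner n f R \<eta> x0 v0 (i (Suc s)) (sada_stage_length \<mu> m\<^sub>1 (Suc s))
      = sada_inner n f R \<eta> x0 v0 (i' (Suc s)) (sada_stage_length \<mu> m\<^sub>1 (Suc s))" for x0 v0
    using Suc.prems by (intro sada_inner_cong) auto
  ultimately show ?case by simp
qed simp

section \<open>A full stage\<close>

context composite_problem
begin

text \<open>The state after \<open>t\<close> iterations and the starting points of the stage do not depend on draw \<open>Suc t\<close>
  of row \<open>r\<close>, so that draw can be resampled and \<open>sum_potential_step\<close> applies at each fixed past.\<close>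

lemma sum_potential_stage:
  fixes X0 V0 :: "(nat \<times> nat \<Rightarrow> nat) \<Rightarrow> 'a" and J :: "(nat \<times> nat) set" and r m :: nat
  defines "W \<equiv> PiE J (\<lambda>_. {1..n})"
  defines "S \<equiv> \<lambda>w. sada_inner n f R (5 * L) (X0 w) (V0 w) (\<lambda>t. w (r, t))"
  assumes J: "{r} \<times> {1..m} \<subseteq> J"
    and X0: "\<And>w t b. X0 (w((r, t) := b)) = X0 w" and V0: "\<And>w t b. V0 (w((r, t) := b)) = V0 w"
  shows "(\<Sum>w\<in>W. potential m (V0 w) m (S w m)) \<le> (\<Sum>w\<in>W. potential m (V0 w) 0 (S w 0))"
proof -
  have "(\<Sum>w\<in>W. potential m (V0 w) t (S w t)) \<le> (\<Sum>w\<in>W. potential m (V0 w) 0 (S w 0))"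
    if "t \<le> m" for t
    using that
  proof (induction t)
    case (Suc t)
    let ?h = "\<lambda>w. potential m (V0 w) (Suc t) (S w (Suc t))"
    have past: "S (w((r, Suc t) := b)) t = S w t" for w b
      unfolding S_def X0 V0 by (rule sada_inner_cong) simp
    have step: "?h (w((r, Suc t) := b))
        = potential m (V0 w) (Suc t) (sada_step n f R (5 * L) (V0 w) (Suc t) b (S w t))" for w b
      using past[of w b] by (simp add: S_def X0 V0)
    have "(r, Suc t) \<in> J"
      using J Suc.prems by auto
    then have "real n * (\<Sum>w\<in>W. ?h w) = (\<Sum>w\<in>W. \<Sum>b = 1..n. ?h (w((r, Suc t) := b)))"
      using sum_PiE_resample[of "(r, Suc t)" J ?h "{1..n}"] by (simp add: W_def)
    also have "\<dots> \<le> (\<Sum>w\<in>W. real n * potential m (V0 w) t (S w t))"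
      unfolding step using Suc.prems valid_state_inner
      by (intro sum_mono sum_potential_step) (auto simp: S_def)
    finally have "(\<Sum>w\<in>W. ?h w) \<le> (\<Sum>w\<in>W. potential m (V0 w) t (S w t))"
      using n by (simp flip: sum_distrib_left)
    also have "\<dots> \<le> (\<Sum>w\<in>W. potential m (V0 w) 0 (S w 0))"
      using Suc by simp
    finally show ?case .
  qed simp
  then show ?thesis by simp
qed

text \<open>Convexity of the squared norm splits the distance from \<open>xstar\<close> to the starting point \<open>v\<^sub>0\<close>, a convex
  combination of the previous outer iterates.\<close>

lemma sum_stage:
  fixes J :: "(nat \<times> nat) set" and xinit :: 'a and \<alpha> :: real and s m\<^sub>1 :: nat
  defines "W \<equiv> PiE J (\<lambda>_. {1..n})"
  defines "m \<equiv> sada_stage_length \<mu> m\<^sub>1 (Suc s)"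
  defines "it \<equiv> \<lambda>w. sada n f R \<mu> (5 * L) m\<^sub>1 \<alpha> xinit (\<lambda>r t. w (r, t))"
  assumes J: "{Suc s} \<times> {1..m} \<subseteq> J" and m1: "m\<^sub>1 \<ge> 1" and \<alpha>: "0 \<le> \<alpha>" "\<alpha> \<le> 1"
  shows "(\<Sum>w\<in>W. P (fst (it w (Suc s))) - P xstar)
      + (5 * L + real m * \<mu>) / (2 * real m) * (\<Sum>w\<in>W. (norm (snd (it w (Suc s)) - xstar))\<^sup>2)
    \<le> 1 / 2 * (\<Sum>w\<in>W. P (fst (it w s)) - P xstar)
      + (\<alpha> * (5 * L) / (2 * real m) - \<mu> / 4) * (\<Sum>w\<in>W. (norm (fst (it w s) - xstar))\<^sup>2)
      + (1 - \<alpha>) * (5 * L) / (2 * real m) * (\<Sum>w\<in>W. (norm (snd (it w s) - xstar))\<^sup>2)"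
proof -
  define X0 where "X0 w = fst (it w s)" for w
  define V where "V w = snd (it w s)" for w
  define V0 where "V0 w = (1 - \<alpha>) *\<^sub>R V w + \<alpha> *\<^sub>R X0 w" for w
  define S where "S w = sada_inner n f R (5 * L) (X0 w) (V0 w) (\<lambda>t. w (Suc s, t))" for w
  have m: "m > 0"
    using m1 by (auto simp: m_def sada_stage_length_def)
  have it_Suc: "it w (Suc s) = (st_x (S w m), st_v (S w m))" for w
    by (simp add: it_def S_def X0_def V_def V0_def m_def case_prod_beta Let_def)
  have it_past: "it (w((Suc s, t) := b)) s = it w s" for w t b
    unfolding it_def by (rule sada_cong) simp
  have final: "P (st_x (S w m)) - P xstar
      + (5 * L + real m * \<mu>) / (2 * real m) * (norm (st_v (S w m) - xstar))\<^sup>2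
      \<le> potential m (V0 w) m (S w m) / real m" for w
  proof -
    have "(real m * (P (st_x (S w m)) - P xstar)
          + (5 * L + real m * \<mu>) / 2 * (norm (st_v (S w m) - xstar))\<^sup>2) / real m
        \<le> potential m (V0 w) m (S w m) / real m"
      unfolding S_def by (intro divide_right_mono potential_final_ge valid_state_inner) simp
    moreover have "(real m * a + b / 2 * c) / real m = a + b / (2 * real m) * c" for a b c
      using m by (simp add: field_simps)
    ultimately show ?thesis by simp
  qed
  have initial: "potential m (V0 w) 0 (S w 0) / real m
      \<le> 1 / 2 * (P (X0 w) - P xstar)
        + (\<alpha> * (5 * L) / (2 * real m) - \<mu> / 4) * (norm (X0 w - xstar))\<^sup>2
        + (1 - \<alpha>) * (5 * L) / (2 * real m) * (norm (V w - xstar))\<^sup>2" for w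
  proof -
    have "(norm (xstar - V0 w))\<^sup>2
        \<le> (1 - \<alpha>) * (norm (V w - xstar))\<^sup>2 + \<alpha> * (norm (X0 w - xstar))\<^sup>2"
    proof -
      have "V0 w - xstar = (1 - \<alpha>) *\<^sub>R (V w - xstar) + \<alpha> *\<^sub>R (X0 w - xstar)"
        by (simp add: V0_def algebra_simps)
      then have "norm (xstar - V0 w)
          \<le> (1 - \<alpha>) * norm (V w - xstar) + \<alpha> * norm (X0 w - xstar)"
        using \<alpha> norm_triangle_ineq[of "(1 - \<alpha>) *\<^sub>R (V w - xstar)" "\<alpha> *\<^sub>R (X0 w - xstar)"]
        by (simp add: norm_minus_commute[of xstar])
      then have "(norm (xstar - V0 w))\<^sup>2
          \<le> ((1 - \<alpha>) * norm (V w - xstar) + \<alpha> * norm (X0 w - xstar))\<^sup>2"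
        by (intro power_mono) auto
      also have "\<dots> \<le> (1 - \<alpha>) * (norm (V w - xstar))\<^sup>2 + \<alpha> * (norm (X0 w - xstar))\<^sup>2"
        using convex_onD[OF convex_power2, of \<alpha> "norm (V w - xstar)" "norm (X0 w - xstar)"] \<alpha>
        by simp
      finally show ?thesis .
    qed
    then have "5 * L / 2 * (norm (xstar - V0 w))\<^sup>2
        \<le> 5 * L / 2 * ((1 - \<alpha>) * (norm (V w - xstar))\<^sup>2 + \<alpha> * (norm (X0 w - xstar))\<^sup>2)"
      using L by (intro mult_left_mono) auto
    with potential_init_le[of m "V0 w" "X0 w"]
    have "potential m (V0 w) 0 (S w 0)
        \<le> 5 * L / 2 * ((1 - \<alpha>) * (norm (V w - xstar))\<^sup>2 + \<alpha> * (norm (X0 w - xstar))\<^sup>2)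
          + real m / 2 * (P (X0 w) - P xstar - \<mu> / 2 * (norm (X0 w - xstar))\<^sup>2)"
      unfolding S_def by simp
    then have "potential m (V0 w) 0 (S w 0) / real m
        \<le> (5 * L / 2 * ((1 - \<alpha>) * (norm (V w - xstar))\<^sup>2 + \<alpha> * (norm (X0 w - xstar))\<^sup>2)
          + real m / 2 * (P (X0 w) - P xstar - \<mu> / 2 * (norm (X0 w - xstar))\<^sup>2)) / real m"
      by (rule divide_right_mono) simp
    moreover have "(5 * L / 2 * ((1 - \<alpha>) * a + \<alpha> * b) + real m / 2 * (c - \<mu> / 2 * b)) / real m
        = 1 / 2 * c + (\<alpha> * (5 * L) / (2 * real m) - \<mu> / 4) * b + (1 - \<alpha>) * (5 * L) / (2 * real m) * a"
      for a b c
      using m by (simp add: field_simps)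
    ultimately show ?thesis by simp
  qed
  have "(\<Sum>w\<in>W. P (st_x (S w m)) - P xstar)
      + (5 * L + real m * \<mu>) / (2 * real m) * (\<Sum>w\<in>W. (norm (st_v (S w m) - xstar))\<^sup>2)
      \<le> (\<Sum>w\<in>W. potential m (V0 w) m (S w m) / real m)"
    unfolding sum_distrib_left sum.distrib[symmetric] by (intro sum_mono final)
  also have "\<dots> \<le> (\<Sum>w\<in>W. potential m (V0 w) 0 (S w 0) / real m)"
    unfolding sum_divide_distrib[symmetric] W_def S_def
    by (intro divide_right_mono sum_potential_stage J)
      (simp_all add: X0_def V0_def V_def it_past)
  also have "\<dots> \<le> 1 / 2 * (\<Sum>w\<in>W. P (X0 w) - P xstar)
      + (\<alpha> * (5 * L) / (2 * real m) - \<mu> / 4) * (\<Sum>w\<in>W. (norm (X0 w - xstar))\<^sup>2)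
      + (1 - \<alpha>) * (5 * L) / (2 * real m) * (\<Sum>w\<in>W. (norm (V w - xstar))\<^sup>2)"
    unfolding sum_distrib_left sum.distrib[symmetric] by (intro sum_mono initial)
  finally show ?thesis
    by (simp add: it_Suc X0_def V_def)
qed

end

theorem theorem5p4:
  fixes f :: "nat \<Rightarrow> real ^ 'd \<Rightarrow> real"
    and R P :: "real ^ 'd \<Rightarrow> real"
    and L :: "nat \<Rightarrow> real"
    and Lmax \<mu> \<eta> \<alpha> :: real
    and n m\<^sub>1 s :: nat
    and m :: "nat \<Rightarrow> nat"
    and xstar xinit :: "real ^ 'd"
    and M :: "'w measure"
    and draw :: "nat \<Rightarrow> nat \<Rightarrow> 'w \<Rightarrow> nat"
    and xt vt :: "nat \<Rightarrow> 'w \<Rightarrow> real ^ 'd"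
  assumes n: "n \<ge> 1"
    and f_convex: "\<And>i. i \<in> {1..n} \<Longrightarrow> convex_on UNIV (f i)"
    and f_differentiable: "\<And>i x. i \<in> {1..n} \<Longrightarrow> f i differentiable (at x)"
    and f_smooth: "\<And>i. i \<in> {1..n} \<Longrightarrow> (L i)-lipschitz_on UNIV (gradient (f i))"
    and Lmax: "Lmax = Max (L ` {1..n})" "Lmax > 0"
    and mu: "\<mu> \<ge> 0"
    and R: "strongly_convex \<mu> R"
    and P: "P = (\<lambda>x. (1 / real n) * (\<Sum>i = 1..n. f i x) + R x)"
    and xstar: "is_arg_min P (\<lambda>_. True) xstar"
    and eta: "\<eta> = 5 * Lmax"
    and m1: "m\<^sub>1 \<ge> 1"
    and alpha: "0 \<le> \<alpha>" "\<alpha> \<le> 1"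
    and m: "m = sada_stage_length \<mu> m\<^sub>1"
    and M: "prob_space M"
    and draw_indep: "prob_space.indep_vars M (\<lambda>_. count_space UNIV) (\<lambda>(r, t). draw r t)
                       {(r, t). 1 \<le> r \<and> 1 \<le> t \<and> t \<le> m r}"
    and draw_uniform: "\<And>r t. 1 \<le> r \<Longrightarrow> 1 \<le> t \<Longrightarrow> t \<le> m r \<Longrightarrow>
                         distr M (count_space UNIV) (draw r t) = measure_pmf (pmf_of_set {1..n})"
    and xt: "xt = (\<lambda>r \<omega>. fst (sada n f R \<mu> \<eta> m\<^sub>1 \<alpha> xinit (\<lambda>r t. draw r t \<omega>) r))"
    and vt: "vt = (\<lambda>r \<omega>. snd (sada n f R \<mu> \<eta> m\<^sub>1 \<alpha> xinit (\<lambda>r t. draw r t \<omega>) r))"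
    and s: "s \<ge> 1"
  shows "prob_space.expectation M (\<lambda>\<omega>. P (xt s \<omega>) - P xstar)
           + (\<eta> + real (m s) * \<mu>) / (2 * real (m s))
               * prob_space.expectation M (\<lambda>\<omega>. (norm (vt s \<omega> - xstar))\<^sup>2)
         \<le> 1 / 2 * prob_space.expectation M (\<lambda>\<omega>. P (xt (s - 1) \<omega>) - P xstar)
           + (\<alpha> * \<eta> / (2 * real (m s)) - \<mu> / 4)
               * prob_space.expectation M (\<lambda>\<omega>. (norm (xt (s - 1) \<omega> - xstar))\<^sup>2)
           + (1 - \<alpha>) * \<eta> / (2 * real (m s))
               * prob_space.expectation M (\<lambda>\<omega>. (norm (vt (s - 1) \<omega> - xstar))\<^sup>2)"
proof -
  interpret prob_space M by (rule M)
  have "L i \<le> Lmax" if "i \<in> {1..n}" for i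
    using that unfolding Lmax(1) by (intro Max_ge) auto
  then have "Lmax-lipschitz_on UNIV (gradient (f i))" if "i \<in> {1..n}" for i
    using that f_smooth lipschitz_on_le by blast
  then interpret composite_problem n f R P Lmax \<mu> xstar
    using n f_convex f_differentiable Lmax(2) mu R P xstar
    by unfold_locales (auto simp: is_arg_min_linorder)
  define J where "J = Sigma {1..s} (\<lambda>r. {1..m r})"
  define it where "it w r = sada n f R \<mu> \<eta> m\<^sub>1 \<alpha> xinit (\<lambda>r t. w (r, t)) r" for w r
  define E where "E h = (\<Sum>w\<in>PiE J (\<lambda>_. {1..n}). h w) / real n ^ card J" for h :: "_ \<Rightarrow> real"
  have J: "finite J" "J \<subseteq> {(r, t). 1 \<le> r \<and> 1 \<le> t \<and> t \<le> m r}"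
    by (auto simp: J_def)
  have indep: "indep_vars (\<lambda>_. count_space UNIV) (\<lambda>(r, t). draw r t) J"
    using draw_indep J(2) by (rule indep_vars_subset)
  have unif: "distr M (count_space UNIV) (case j of (r, t) \<Rightarrow> draw r t)
      = measure_pmf (pmf_of_set {1..n})" if "j \<in> J" for j
  proof -
    obtain r t where j: "j = (r, t)" by (cases j)
    then show ?thesis
      using that by (simp add: J_def draw_uniform)
  qed
  have sada_eq: "sada n f R \<mu> \<eta> m\<^sub>1 \<alpha> xinit (\<lambda>r t. draw r t w) r
      = it (\<lambda>j\<in>J. (case j of (r, t) \<Rightarrow> draw r t) w) r" if "r \<le> s" for r w
    unfolding it_def using that by (intro sada_cong) (auto simp: J_def m)
  have E_eq: "expectation (\<lambda>w. h (sada n f R \<mu> \<eta> m\<^sub>1 \<alpha> xinit (\<lambda>r t. draw r t w) r))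
      = E (\<lambda>w. h (it w r))" if "r \<le> s" for r and h :: "_ \<Rightarrow> real"
    using expectation_uniform_draws[OF indep J(1) _ _ unif, of "\<lambda>w. h (it w r)"] n that
    by (simp add: sada_eq E_def)
  note E_P = E_eq[of _ "\<lambda>z. P (fst z) - P xstar"]
    and E_x = E_eq[of _ "\<lambda>z. (norm (fst z - xstar))\<^sup>2"]
    and E_v = E_eq[of _ "\<lambda>z. (norm (snd z - xstar))\<^sup>2"]
  obtain s' where s': "s = Suc s'"
    using s by (cases s) auto
  have "E (\<lambda>w. P (fst (it w s)) - P xstar)
      + (\<eta> + real (m s) * \<mu>) / (2 * real (m s)) * E (\<lambda>w. (norm (snd (it w s) - xstar))\<^sup>2)
    \<le> 1 / 2 * E (\<lambda>w. P (fst (it w s')) - P xstar)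
      + (\<alpha> * \<eta> / (2 * real (m s)) - \<mu> / 4) * E (\<lambda>w. (norm (fst (it w s') - xstar))\<^sup>2)
      + (1 - \<alpha>) * \<eta> / (2 * real (m s)) * E (\<lambda>w. (norm (snd (it w s') - xstar))\<^sup>2)"
    unfolding E_def times_divide_eq_right add_divide_distrib[symmetric] it_def eta m s'
    using m1 alpha by (intro divide_right_mono sum_stage) (auto simp: J_def s' m)
  then show ?thesis
    using E_P[of s] E_v[of s] E_P[of s'] E_x[of s'] E_v[of s'] s'
    unfolding xt vt by simp
qed

end
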